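(* For $n=0,1,2,\ldots$ we have $$t_n^2=-\big((2n+1)!\big)^2\sum_{k=0}^{2n+1}\binom{2n+1+k}{2k}\binom{2k}{k}^2\frac{1}{(-4)^k}\sum_{i=1}^k\frac{1}{(2i-1)^2}$$ and $$t_n^2=-\big((2n+1)!\big)^2\sum_{k=0}^{2n+1}\binom{2n+1+k}{2k}\binom{2k}{k}^2\frac{1}{(-4)^k}\Big(\sum_{i=1}^k\frac{1}{2i-1}\Big)^2.$$
   Context: The sequence $\{t_n\}_{n\ge 0}$ is defined by $t_0=1$, $t_1=5$ and $t_{n+1}=(8n^2+12n+5)t_n-4n^2(2n+1)^2t_{n-1}$ for $n\ge 1$. Empty sums are $0$. *)

theory Defs
  imports Complex_Main
begin

(* The recurrence is shifted by one here; see t_seq_rec for its usual form. *)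
fun t_seq :: "nat \<Rightarrow> int" where
  "t_seq 0 = 1"
| "t_seq (Suc 0) = 5"
| "t_seq (Suc (Suc m)) =
     (let n = int (Suc m) in
       (8 * n ^ 2 + 12 * n + 5) * t_seq (Suc m) - 4 * n ^ 2 * (2 * n + 1) ^ 2 * t_seq m)"

lemma t_seq_rec:
  assumes "n \<ge> 1"
  shows "t_seq (n + 1) =
    (8 * int n ^ 2 + 12 * int n + 5) * t_seq n - 4 * int n ^ 2 * (2 * int n + 1) ^ 2 * t_seq (n - 1)"
proof -
  obtain m where "n = Suc m"
    using assms by (cases n) auto
  then show ?thesis
    by (simp only: Suc_eq_plus1[symmetric] t_seq.simps Let_def diff_Suc_1)
qed

end

theory Submission
  imports Defs "HOL-Computational_Algebra.Polynomial"
begin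

text \<open>
  Everything takes place in polynomials in one variable \<open>z\<close>. Let
  \<open>d\<^sub>0 = 1\<close>, \<open>d\<^sub>1 = z\<close>, \<open>(N + 1) d\<^sub>N\<^sub>+\<^sub>1 = z d\<^sub>N + N d\<^sub>N\<^sub>-\<^sub>1\<close>; these are the Delannoy
  polynomials \<open>\<Sum>k. (N choose k) (x choose k) 2 ^ k\<close> at \<open>x = (z - 1) / 2\<close>. The recurrence shows
  that \<open>d\<^sub>N\<close> has the parity of \<open>N\<close>, and following the lowest coefficients of \<open>d\<^sub>2\<^sub>n\<close> and \<open>d\<^sub>2\<^sub>n\<^sub>+\<^sub>1\<close> turns it
  into the recurrence for \<open>t\<^sub>n\<close>: the coefficient of \<open>z\<close> in \<open>d\<^sub>2\<^sub>n\<^sub>+\<^sub>1\<close> is \<open>t\<^sub>n / (2n + 1)!\<close>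
  (\<open>t_seq_eq_coeff\<close>). Hence \<open>(t\<^sub>n / (2n + 1)!)\<^sup>2\<close> is the coefficient of \<open>z\<^sup>2\<close> in the square of
  \<open>d\<^sub>2\<^sub>n\<^sub>+\<^sub>1\<close>.

  Write \<open>w\<^sub>k = (2k choose k)\<^sup>2 / (-4) ^ k\<close>. For the first formula, the square has the expansion
  \<open>d\<^sub>N\<^sup>2 = \<Sum>k. (N + k choose 2k) w\<^sub>k \<Prod>i=1..k. (1 - z\<^sup>2 / (2i - 1)\<^sup>2)\<close>
  (\<open>delannoy_poly_square\<close>), and the coefficient of \<open>z\<^sup>2\<close> in the product is the sum
  \<open>- (\<Sum>i=1..k. 1 / (2i - 1)\<^sup>2)\<close>.

  For the second formula, replace the product by \<open>\<Prod>i=1..k. (1 + z / (2i - 1))\<close>. The resulting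
  sum \<open>h\<^sub>N\<close> is a continuous Hahn polynomial, so it also has the parity of \<open>N\<close>, and for odd \<open>N\<close> its
  coefficient of \<open>z\<^sup>2\<close> vanishes. In the product this coefficient is half the difference between the square
  of \<open>\<Sum>i=1..k. 1 / (2i - 1)\<close> and \<open>\<Sum>i=1..k. 1 / (2i - 1)\<^sup>2\<close>. So the two inner sums give the
  same total (\<open>odd_harmonic_sums_eq\<close>).

  Both the expansion of \<open>d\<^sub>N\<^sup>2\<close> and the parity of \<open>h\<^sub>N\<close> come from recurrences in \<open>N\<close>. For any
  sequence \<open>g\<close> put \<open>S\<^sub>N = \<Sum>k. (N + k choose 2k) g\<^sub>k\<close> (\<open>binomial_sum\<close>). The combination
  \<open>(N + 2)\<^sup>2 S\<^sub>N\<^sub>+\<^sub>2 - (N + 1)\<^sup>2 S\<^sub>N\<close> has coefficients in the \<open>g\<^sub>k\<close> that can be split over two neighbouring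
  indices in two ways, one for each of the two-term recurrences that the products satisfy
  (\<open>weighted_binomial_diff_quadratic\<close>, \<open>weighted_binomial_diff_linear\<close>).
\<close>

section \<open>Binomial coefficients\<close>

text \<open>
  Subtracting in the reals is safe even for \<open>m < i\<close>, where both sides vanish. This matters
  because the identities below are applied beyond the support of their binomial coefficients.
\<close>

lemma choose_Suc_real:
  "real (Suc i) * real (m choose Suc i) = (real m - real i) * real (m choose i)"
proof (cases "i \<le> m")
  case True
  then show ?thesis
    using binomial_absorb_comp[of m i] binomial_absorption[of i m]
    by (metis binomial_absorb_comp binomial_absorption of_nat_diff of_nat_mult)
qed (simp add: binomial_eq_0)

lemma Suc_choose_Suc_real:
  "real (Suc i) * real (Suc m choose Suc i) = real (Suc m) * real (m choose i)"
  using Suc_times_binomial_eq[of m i] by (metis mult.commute of_nat_mult)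

lemma central_binomial_Suc_real:
  "real (Suc k) * real ((2 * Suc k) choose Suc k) = 2 * (2 * real k + 1) * real ((2 * k) choose k)"
proof -
  have 1: "real (Suc k) * real (Suc (2*k+1) choose Suc k) = real (Suc (2*k+1)) * real ((2*k+1) choose k)"
    by (rule Suc_choose_Suc_real)
  have 2: "(2*k+1) choose k = (2*k+1) choose Suc k"
    by (subst binomial_symmetric) auto
  have 3: "real (Suc k) * real (Suc (2*k) choose Suc k) = real (Suc (2*k)) * real ((2*k) choose k)"
    by (rule Suc_choose_Suc_real)
  have "real (Suc k) * (real (Suc k) * real (Suc (2*k+1) choose Suc k))
      = real (Suc k) * (2 * (2 * real k + 1) * real ((2 * k) choose k))"
    unfolding 1 2 using 3 by (simp add: algebra_simps)
  then show ?thesis by (simp del: binomial_Suc_Suc)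
qed

text \<open>
  The coefficient of \<open>g\<^sub>k\<close> in \<open>(N + 2)\<^sup>2 S\<^sub>N\<^sub>+\<^sub>2 - (N + 1)\<^sup>2 S\<^sub>N\<close>, where \<open>S\<^sub>N = \<Sum>k. (N + k choose 2k) g\<^sub>k\<close>.
\<close>

definition weighted_binomial_diff :: "nat \<Rightarrow> nat \<Rightarrow> real" where
  "weighted_binomial_diff N k = (real N + 2)\<^sup>2 * real ((N + 2 + k) choose (2 * k))
     - (real N + 1)\<^sup>2 * real ((N + k) choose (2 * k))"

text \<open>
  All binomial coefficients that occur in the two splittings below are rational multiples of
  \<open>c = (N + 1 + j choose 2j)\<close>, the one with the smallest lower index. Starting from the
  smallest one keeps every denominator nonzero for all \<open>N\<close> and \<open>j\<close>.
\<close>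

lemma binomials_from_base:
  fixes N j :: nat
  defines "c \<equiv> real ((N + 1 + j) choose (2 * j))"
  shows "real ((N + 1 + j) choose (2*j+1)) = (real N + 1 - real j) / (2*real j+1) * c" (is ?A)
    and "real ((N + 2 + j) choose (2*j+1)) = (real N + 2 + real j) / (2*real j+1) * c" (is ?B)
    and "real ((N + 2 + j) choose (2*j+2)) = (real N + 2 + real j) * (real N + 1 - real j) / ((2*real j+1) * (2*real j+2)) * c" (is ?C)
    and "real ((N + 2 + j) choose (2*j+3)) = (real N - real j) / (2*real j+3) * ((real N + 2 + real j) * (real N + 1 - real j) / ((2*real j+1) * (2*real j+2)) * c)" (is ?D)
    and "real ((N + 3 + j) choose (2*j+3)) = (real N + 3 + real j) / (2*real j+3) * ((real N + 2 + real j) * (real N + 1 - real j) / ((2*real j+1) * (2*real j+2)) * c)" (is ?E)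
    and "real ((N + 3 + j) choose (2*j+2)) = (real N + 3 + real j) / (2*real j+2) * ((real N + 2 + real j) / (2*real j+1) * c)" (is ?F)
    and "real ((N + 1 + j) choose (2*j+2)) = (real N - real j) / (2*real j+2) * ((real N + 1 - real j) / (2*real j+1) * c)" (is ?G)
proof -
  have down: "real (m choose Suc i) = (real m - real i) / real (Suc i) * real (m choose i)" for m i
    using choose_Suc_real[of i m] by (simp add: field_simps)
  have up: "real (Suc m choose Suc i) = real (Suc m) / real (Suc i) * real (m choose i)" for m i
    using Suc_choose_Suc_real[of i m] by (simp add: field_simps del: binomial_Suc_Suc)
  have ns: "2*j+1 = Suc (2*j)" "2*j+2 = Suc (2*j+1)" "2*j+3 = Suc (2*j+2)"
    "N+2+j = Suc (N+1+j)" "N+3+j = Suc (N+2+j)" by simp_all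
  show A: ?A
    using down[of "N+1+j" "2*j"] unfolding c_def ns(1) by (simp add: algebra_simps)
  show B: ?B
    using up[of "N+1+j" "2*j"] unfolding c_def ns(1) ns(4) by (simp add: algebra_simps)
  show C: ?C
    using up[of "N+1+j" "2*j+1"] unfolding A ns(2) ns(4) by (simp add: algebra_simps)
  show D: ?D
    using down[of "N+2+j" "2*j+2"] unfolding C ns(3) by (simp add: algebra_simps)
  show E: ?E
    using up[of "N+2+j" "2*j+2"] unfolding C ns(3) ns(5) by (simp add: algebra_simps)
  show F: ?F
    using up[of "N+2+j" "2*j+1"] unfolding B ns(2) ns(5) by (simp add: algebra_simps)
  show G: ?G
    using down[of "N+1+j" "2*j+1"] unfolding A ns(2) by (simp add: algebra_simps)
qed

lemma weighted_binomial_diff_0: "weighted_binomial_diff N 0 = 2 * real N + 3"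
  by (simp add: weighted_binomial_diff_def power2_eq_square algebra_simps)

text \<open>
  The two summands are \<open>(2k + 1)\<^sup>2 a\<^sub>k + k\<^sup>2 a\<^sub>k\<^sub>-\<^sub>1\<close> at \<open>k = j + 1\<close>, where
  \<open>a\<^sub>k = (N + 1 + k choose 2k + 1) + (N + 2 + k choose 2k + 1)\<close> is the coefficient of \<open>g\<^sub>k\<close> in
  two consecutive partial sums of \<open>S\<^sub>0, S\<^sub>1, \<dots>\<close> added together.
\<close>

lemma weighted_binomial_diff_quadratic:
  "weighted_binomial_diff N (Suc j) =
     (2 * real j + 3)\<^sup>2 * (real ((N + 2 + j) choose (2*j+3)) + real ((N + 3 + j) choose (2*j+3)))
   + (real j + 1)\<^sup>2 * (real ((N + 1 + j) choose (2*j+1)) + real ((N + 2 + j) choose (2*j+1)))"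
proof -
  have e: "N + 2 + Suc j = N + 3 + j" "N + Suc j = N + 1 + j" "2 * Suc j = 2*j+2" by simp_all
  have nz: "2*real j+1 \<noteq> 0" "2*real j+2 \<noteq> 0" "2*real j+3 \<noteq> 0" by linarith+
  show ?thesis
    unfolding weighted_binomial_diff_def e binomials_from_base using nz
    by (simp add: divide_simps power2_eq_square) (simp add: algebra_simps)
qed

text \<open>
  Here the splitting is \<open>(2k + 1) a\<^sub>k + k\<^sup>2 / (2k - 1) a\<^sub>k\<^sub>-\<^sub>1\<close> at \<open>k = j + 1\<close>, where
  \<open>a\<^sub>k = (2N + 3) (N + 1 + k choose 2k)\<close> is a multiple of the coefficient of \<open>g\<^sub>k\<close> in
  \<open>S\<^sub>N\<^sub>+\<^sub>1\<close>.
\<close>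

lemma weighted_binomial_diff_linear:
  "weighted_binomial_diff N (Suc j) =
     (2 * real N + 3) * ((2 * real j + 3) * real ((N + 2 + j) choose (2*j+2))
       + (real j + 1)\<^sup>2 / (2 * real j + 1) * real ((N + 1 + j) choose (2*j)))"
proof -
  have e: "N + 2 + Suc j = N + 3 + j" "N + Suc j = N + 1 + j" "2 * Suc j = 2*j+2" by simp_all
  have nz: "2*real j+1 \<noteq> 0" "2*real j+2 \<noteq> 0" "2*real j+3 \<noteq> 0" by linarith+
  show ?thesis
    unfolding weighted_binomial_diff_def e binomials_from_base using nz
    by (simp add: divide_simps power2_eq_square) (simp add: algebra_simps)
qed

section \<open>Recurrences for sums over binomial coefficients\<close>

definition binomial_sum :: "(nat \<Rightarrow> real) \<Rightarrow> nat \<Rightarrow> real" where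
  "binomial_sum g N = (\<Sum>k\<le>N. real ((N + k) choose (2 * k)) * g k)"

lemma binomial_sum_extend:
  assumes "N \<le> K"
  shows "binomial_sum g N = (\<Sum>k\<le>K. real ((N + k) choose (2 * k)) * g k)"
  unfolding binomial_sum_def using assms
  by (intro sum.mono_neutral_left) (auto simp: binomial_eq_0)

text \<open>
  Summing the outer index turns \<open>(N + k choose 2k)\<close> into \<open>(N + 1 + k choose 2k + 1)\<close> by the
  hockey-stick identity.
\<close>

lemma sum_binomial_sum:
  assumes "N \<le> K"
  shows "(\<Sum>j\<le>N. binomial_sum g j) = (\<Sum>k\<le>K. real ((N + 1 + k) choose (2 * k + 1)) * g k)"
  using assms
proof (induction N)
  case 0
  have "(\<Sum>k\<le>K. real ((0 + 1 + k) choose (2 * k + 1)) * g k) =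
      (\<Sum>k\<in>{0}. real ((0 + 1 + k) choose (2 * k + 1)) * g k)"
    by (intro sum.mono_neutral_right) (auto simp: binomial_eq_0)
  then show ?case by (simp add: binomial_sum_def)
next
  case (Suc N)
  have p: "(Suc N + 1 + k) choose (2*k+1) = ((N + 1 + k) choose (2*k+1)) + ((Suc N + k) choose (2*k))" for k
    by simp
  show ?case
    using Suc unfolding p by (simp add: binomial_sum_extend[OF Suc.prems] sum.distrib[symmetric] algebra_simps)
qed

lemma binomial_sum_weighted_binomial_diff:
  "(real N + 2)\<^sup>2 * binomial_sum g (N + 2) - (real N + 1)\<^sup>2 * binomial_sum g N = (\<Sum>k\<le>N + 2. weighted_binomial_diff N k * g k)"
proof -
  have "binomial_sum g N = (\<Sum>k\<le>N + 2. real ((N + k) choose (2 * k)) * g k)"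
    by (rule binomial_sum_extend) simp
  then show ?thesis
    by (simp only: binomial_sum_def weighted_binomial_diff_def sum_distrib_left sum_subtractf[symmetric] left_diff_distrib mult.assoc)
qed

lemma sum_shift_index:
  fixes a h :: "nat \<Rightarrow> real"
  assumes "a K = 0"
  shows "(\<Sum>k\<le>K. a k * h (Suc k)) = (\<Sum>k\<le>K. (case k of 0 \<Rightarrow> 0 | Suc j \<Rightarrow> a j * h k))"
proof -
  have "(\<Sum>k\<le>Suc K. (case k of 0 \<Rightarrow> 0 | Suc j \<Rightarrow> a j * h k)) = (\<Sum>k\<le>K. a k * h (Suc k))"
    by (subst sum.atMost_Suc_shift) simp
  then show ?thesis using assms by simp
qed

text \<open>
  Multiplying \<open>\<Sum>k. a\<^sub>k g\<^sub>k\<close> by \<open>w\<close> and using the hypothesis on \<open>g\<close> gives, after shifting the index,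
  the coefficients \<open>(2k + 1)\<^sup>2 a\<^sub>k + k\<^sup>2 a\<^sub>k\<^sub>-\<^sub>1\<close> of \<open>weighted_binomial_diff_quadratic\<close>.
\<close>

lemma binomial_sum_rec_quadratic:
  assumes g: "\<And>k. w * g k = (2 * real k + 1)\<^sup>2 * g k + (real k + 1)\<^sup>2 * g (Suc k)"
  shows "(real N + 2)\<^sup>2 * binomial_sum g (N + 2) =
    (real N + 1)\<^sup>2 * binomial_sum g N + w * ((\<Sum>j\<le>N. binomial_sum g j) + (\<Sum>j\<le>Suc N. binomial_sum g j))"
proof -
  \<comment> \<open>One range for all the sums, long enough that \<open>a K = 0\<close> and the shift has no boundary term.\<close>
  define K where "K = N + 2"
  define a where "a k = real ((N + 1 + k) choose (2*k+1)) + real ((N + 2 + k) choose (2*k+1))" for k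
  have "a K = 0" by (simp add: a_def K_def binomial_eq_0)
  have S: "(\<Sum>j\<le>N. binomial_sum g j) + (\<Sum>j\<le>Suc N. binomial_sum g j) = (\<Sum>k\<le>K. a k * g k)"
    by (subst (1 2) sum_binomial_sum[where K = K])
      (simp_all add: K_def a_def sum.distrib[symmetric] distrib_right del: binomial_Suc_Suc)
  have "w * (\<Sum>k\<le>K. a k * g k) = (\<Sum>k\<le>K. a k * (w * g k))"
    by (simp add: sum_distrib_left mult_ac)
  also have "\<dots> = (\<Sum>k\<le>K. (2 * real k + 1)\<^sup>2 * a k * g k)
      + (\<Sum>k\<le>K. (a k * (real k + 1)\<^sup>2) * g (Suc k))"
    unfolding g by (simp add: sum.distrib[symmetric] distrib_left right_diff_distrib mult_ac)
  also have "(\<Sum>k\<le>K. (a k * (real k + 1)\<^sup>2) * g (Suc k))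
      = (\<Sum>k\<le>K. (case k of 0 \<Rightarrow> 0 | Suc j \<Rightarrow> (a j * (real j + 1)\<^sup>2) * g k))"
    by (rule sum_shift_index) (simp add: \<open>a K = 0\<close>)
  also have "(\<Sum>k\<le>K. (2 * real k + 1)\<^sup>2 * a k * g k) + \<dots> = (\<Sum>k\<le>K. weighted_binomial_diff N k * g k)"
  proof (unfold sum.distrib[symmetric], rule sum.cong[OF refl])
    fix k
    show "(2 * real k + 1)\<^sup>2 * a k * g k
        + (case k of 0 \<Rightarrow> 0 | Suc j \<Rightarrow> a j * (real j + 1)\<^sup>2 * g k) = weighted_binomial_diff N k * g k"
    proof (cases k)
      case 0
      then show ?thesis by (simp add: a_def weighted_binomial_diff_0)
    next
      case (Suc j)
      have "N + 1 + Suc j = N + 2 + j" "N + 2 + Suc j = N + 3 + j" "2 * Suc j + 1 = 2*j+3"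
        by simp_all
      then have aS: "a (Suc j) = real ((N + 2 + j) choose (2*j+3)) + real ((N + 3 + j) choose (2*j+3))"
        by (simp only: a_def)
      have "2 * real (Suc j) + 1 = 2 * real j + 3" by simp
      then have "weighted_binomial_diff N (Suc j) = (2 * real (Suc j) + 1)\<^sup>2 * a (Suc j) + (real j + 1)\<^sup>2 * a j"
        by (simp only: weighted_binomial_diff_quadratic aS) (simp only: a_def)
      then show ?thesis
        unfolding Suc nat.case by (simp only: distrib_left mult_ac)
    qed
  qed
  finally show ?thesis using binomial_sum_weighted_binomial_diff[of N g] S by (simp add: K_def)
qed

text \<open>
  The same argument with the other splitting, which yields a three-term recurrence for the
  sums themselves.
\<close>

lemma binomial_sum_rec_linear:
  assumes g: "\<And>k. z * g k = - (2 * real k + 1) * g k - (real k + 1)\<^sup>2 / (2 * real k + 1) * g (Suc k)"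
  shows "(real N + 2)\<^sup>2 * binomial_sum g (N + 2) =
    (real N + 1)\<^sup>2 * binomial_sum g N - (2 * real N + 3) * z * binomial_sum g (N + 1)"
proof -
  define K where "K = N + 2"
  define a where "a k = (2 * real N + 3) * real ((N + 1 + k) choose (2*k))" for k
  have "a K = 0" by (simp add: a_def K_def binomial_eq_0)
  have S: "(2 * real N + 3) * binomial_sum g (N + 1) = (\<Sum>k\<le>K. a k * g k)"
    by (subst binomial_sum_extend[where K = K]) (simp_all add: K_def a_def sum_distrib_left mult_ac del: binomial_Suc_Suc sum.atMost_Suc)
  have zg: "- (z * g k) = (2 * real k + 1) * g k + (real k + 1)\<^sup>2 / (2 * real k + 1) * g (Suc k)" for k
    unfolding g by (simp add: algebra_simps)
  have "- (z * (\<Sum>k\<le>K. a k * g k)) = (\<Sum>k\<le>K. a k * (- (z * g k)))"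
    by (simp add: sum_distrib_left sum_negf mult_ac)
  also have "\<dots> = (\<Sum>k\<le>K. (2 * real k + 1) * a k * g k)
      + (\<Sum>k\<le>K. (a k * ((real k + 1)\<^sup>2 / (2 * real k + 1))) * g (Suc k))"
    unfolding zg by (simp only: sum.distrib[symmetric] distrib_left mult_ac)
  also have "(\<Sum>k\<le>K. (a k * ((real k + 1)\<^sup>2 / (2 * real k + 1))) * g (Suc k))
      = (\<Sum>k\<le>K. (case k of 0 \<Rightarrow> 0 | Suc j \<Rightarrow> (a j * ((real j + 1)\<^sup>2 / (2 * real j + 1))) * g k))"
    by (rule sum_shift_index) (simp add: \<open>a K = 0\<close>)
  also have "(\<Sum>k\<le>K. (2 * real k + 1) * a k * g k) + \<dots> = (\<Sum>k\<le>K. weighted_binomial_diff N k * g k)"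
  proof (unfold sum.distrib[symmetric], rule sum.cong[OF refl])
    fix k
    show "(2 * real k + 1) * a k * g k
        + (case k of 0 \<Rightarrow> 0 | Suc j \<Rightarrow> a j * ((real j + 1)\<^sup>2 / (2 * real j + 1)) * g k) = weighted_binomial_diff N k * g k"
    proof (cases k)
      case 0
      then show ?thesis by (simp add: a_def weighted_binomial_diff_0)
    next
      case (Suc j)
      have "N + 1 + Suc j = N + 2 + j" "2 * Suc j = 2*j+2"
        by simp_all
      then have aS: "a (Suc j) = (2 * real N + 3) * real ((N + 2 + j) choose (2*j+2))"
        by (simp only: a_def)
      have "2 * real (Suc j) + 1 = 2 * real j + 3" by simp
      then have "weighted_binomial_diff N (Suc j) =
          (2 * real (Suc j) + 1) * a (Suc j) + ((real j + 1)\<^sup>2 / (2 * real j + 1)) * a j"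
        by (simp only: weighted_binomial_diff_linear aS) (simp only: a_def distrib_left mult_ac)
      then show ?thesis
        unfolding Suc nat.case by (simp only: distrib_left mult_ac)
    qed
  qed
  finally have "- (z * ((2 * real N + 3) * binomial_sum g (N + 1))) = (\<Sum>k\<le>N + 2. weighted_binomial_diff N k * g k)"
    unfolding S by (simp only: K_def)
  then show ?thesis using binomial_sum_weighted_binomial_diff[of N g] by (simp only: mult_ac)
qed

section \<open>The square of a Delannoy polynomial\<close>

text \<open>
  With \<open>x = (z - 1) / 2\<close> this is \<open>\<Sum>k\<le>N. (N choose k) (x choose k) 2 ^ k\<close>. The three-term recurrence
  is taken as the definition because parity and the link to \<open>t_seq\<close> are read off from it.
\<close>

fun delannoy_poly :: "nat \<Rightarrow> real poly" where
  "delannoy_poly 0 = 1"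
| "delannoy_poly (Suc 0) = [:0, 1:]"
| "delannoy_poly (Suc (Suc N)) = smult (1 / (real N + 2)) (pCons 0 (delannoy_poly (Suc N)) + smult (real N + 1) (delannoy_poly N))"

definition weight :: "nat \<Rightarrow> real" where
  "weight k = real ((2 * k) choose k) ^ 2 * (1 / (- 4) ^ k)"

lemma weight_Suc: "(real k + 1)\<^sup>2 * weight (Suc k) = - ((2 * real k + 1)\<^sup>2) * weight k"
proof -
  have "(real (Suc k) * real ((2 * Suc k) choose Suc k))\<^sup>2 = (2 * (2 * real k + 1) * real ((2 * k) choose k))\<^sup>2"
    by (simp only: central_binomial_Suc_real)
  then have "(real k + 1)\<^sup>2 * real ((2 * Suc k) choose Suc k)^2 = 4 * (2 * real k + 1)\<^sup>2 * real ((2 * k) choose k)^2"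
    by (simp add: power_mult_distrib add.commute[of 1] del: binomial_Suc_Suc mult_Suc_right distrib_left_numeral)
  then show ?thesis
    unfolding weight_def by (simp add: divide_simps del: binomial_Suc_Suc mult_Suc_right)
qed

definition even_factor :: "nat \<Rightarrow> real poly" where
  "even_factor k = (\<Prod>i = 1..k. [:1, 0, - (1 / (2 * real i - 1) ^ 2):])"

definition linear_factor :: "nat \<Rightarrow> real poly" where
  "linear_factor k = (\<Prod>i = 1..k. [:1, 1 / (2 * real i - 1):])"

lemma poly_even_factor_Suc:
  "poly (even_factor (Suc k)) z = (1 - z\<^sup>2 / (2 * real k + 1)\<^sup>2) * poly (even_factor k) z"
  by (simp add: even_factor_def power2_eq_square algebra_simps)

lemma poly_linear_factor_Suc:
  "poly (linear_factor (Suc k)) z = (1 + z / (2 * real k + 1)) * poly (linear_factor k) z"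
  by (simp add: linear_factor_def algebra_simps)

text \<open>
  From \<open>(N + 2) d\<^sub>N\<^sub>+\<^sub>2 = z d\<^sub>N\<^sub>+\<^sub>1 + (N + 1) d\<^sub>N\<close> one gets
  \<open>(N + 1) d\<^sub>N\<^sub>+\<^sub>1 d\<^sub>N = z (d\<^sub>0\<^sup>2 + \<dots> + d\<^sub>N\<^sup>2)\<close> by multiplying with \<open>d\<^sub>N\<^sub>+\<^sub>1\<close> and telescoping. Multiplying
  with \<open>(N + 2) d\<^sub>N\<^sub>+\<^sub>2\<close> instead then shows that the squares satisfy exactly the recurrence of
  \<open>binomial_sum_rec_quadratic\<close> with \<open>w = z\<^sup>2\<close>. The products are therefore carried along in the
  induction.
\<close>

lemma delannoy_poly_square:
  "poly (delannoy_poly N) z ^ 2 = binomial_sum (\<lambda>k. weight k * poly (even_factor k) z) N"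
proof -
  define d where "d N = poly (delannoy_poly N) z" for N
  define g where "g k = weight k * poly (even_factor k) z" for k
  have d_rec: "(real N + 2) * d (Suc (Suc N)) = z * d (Suc N) + (real N + 1) * d N" for N
    by (simp add: d_def)
  have "z\<^sup>2 * g k = (2 * real k + 1)\<^sup>2 * g k + (real k + 1)\<^sup>2 * g (Suc k)" for k
  proof -
    have "(real k + 1)\<^sup>2 * g (Suc k) = ((real k + 1)\<^sup>2 * weight (Suc k)) * ((1 - z\<^sup>2 / (2 * real k + 1)\<^sup>2) * poly (even_factor k) z)"
      by (simp add: g_def poly_even_factor_Suc mult_ac)
    also have "\<dots> = ((2 * real k + 1)\<^sup>2 * (z\<^sup>2 / (2 * real k + 1)\<^sup>2 - 1)) * g k"
      unfolding weight_Suc by (simp add: g_def algebra_simps)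
    also have "(2 * real k + 1)\<^sup>2 * (z\<^sup>2 / (2 * real k + 1)\<^sup>2 - 1) = z\<^sup>2 - (2 * real k + 1)\<^sup>2"
      by (simp add: right_diff_distrib)
    finally show ?thesis by (simp add: algebra_simps)
  qed
  note rec = binomial_sum_rec_quadratic[of "z\<^sup>2" g, OF this]
  have "d N ^ 2 = binomial_sum g N \<and> d (Suc N) ^ 2 = binomial_sum g (Suc N)
      \<and> (real N + 1) * d (Suc N) * d N = z * (\<Sum>j\<le>N. binomial_sum g j)" for N
  proof (induction N)
    case 0
    show ?case by (simp add: d_def g_def binomial_sum_def even_factor_def weight_def power2_eq_square numeral_2_eq_2 field_simps)
  next
    case (Suc N)
    then have a: "d N ^ 2 = binomial_sum g N" and b: "d (Suc N) ^ 2 = binomial_sum g (Suc N)"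
      and c: "(real N + 1) * d (Suc N) * d N = z * (\<Sum>j\<le>N. binomial_sum g j)" by auto
    have "(real N + 2) * d (Suc (Suc N)) * d (Suc N) = z * d (Suc N) ^ 2 + (real N + 1) * d (Suc N) * d N"
      unfolding d_rec by (simp add: power2_eq_square algebra_simps)
    also have "\<dots> = z * (\<Sum>j\<le>Suc N. binomial_sum g j)"
      unfolding b c by (simp add: algebra_simps)
    finally have c': "(real N + 2) * d (Suc (Suc N)) * d (Suc N) = z * (\<Sum>j\<le>Suc N. binomial_sum g j)" .
    have "(real N + 2)\<^sup>2 * d (Suc (Suc N)) ^ 2 =
        (real N + 2) * d (Suc (Suc N)) * (z * d (Suc N) + (real N + 1) * d N)"
      unfolding d_rec[symmetric] by (simp add: power2_eq_square algebra_simps)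
    also have "\<dots> = z * ((real N + 2) * d (Suc (Suc N)) * d (Suc N))
        + (real N + 1) * d N * ((real N + 2) * d (Suc (Suc N)))"
      by (simp add: algebra_simps)
    also have "\<dots> = z * ((real N + 2) * d (Suc (Suc N)) * d (Suc N))
        + z * ((real N + 1) * d (Suc N) * d N) + (real N + 1)\<^sup>2 * d N ^ 2"
      unfolding d_rec by (simp add: power2_eq_square algebra_simps)
    also have "\<dots> = (real N + 2)\<^sup>2 * binomial_sum g (N + 2)"
      unfolding a c c' rec by (simp add: power2_eq_square algebra_simps)
    finally have "d (Suc (Suc N)) ^ 2 = binomial_sum g (Suc (Suc N))"
      by (simp add: power2_eq_square)
    with b c' show ?case by (simp add: algebra_simps)
  qed
  then show ?thesis unfolding d_def g_def[abs_def] by blast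
qed

section \<open>A continuous Hahn polynomial\<close>

text \<open>
  This is the hypergeometric sum \<open>\<^sub>3F\<^sub>2(-N, N + 1, (1 + z) / 2; 1, 1; 1)\<close>, a continuous Hahn
  polynomial up to normalization and a rotation of the variable.
\<close>

definition hahn_poly :: "nat \<Rightarrow> real poly" where
  "hahn_poly N = (\<Sum>k\<le>N. smult (real ((N + k) choose (2 * k)) * weight k) (linear_factor k))"

lemma poly_hahn_poly: "poly (hahn_poly N) z = binomial_sum (\<lambda>k. weight k * poly (linear_factor k) z) N"
  by (simp add: hahn_poly_def binomial_sum_def poly_sum mult_ac)

text \<open>
  The factor \<open>z\<close> accompanies only the middle term, so the recurrence preserves parity.
\<close>

lemma hahn_poly_rec:
  "smult ((real N + 2)\<^sup>2) (hahn_poly (N + 2)) =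
     smult ((real N + 1)\<^sup>2) (hahn_poly N) - smult (2 * real N + 3) (pCons 0 (hahn_poly (N + 1)))"
proof (rule poly_ext)
  fix z
  define g where "g k = weight k * poly (linear_factor k) z" for k
  have "z * g k = - (2 * real k + 1) * g k - (real k + 1)\<^sup>2 / (2 * real k + 1) * g (Suc k)" for k
  proof -
    have "(real k + 1)\<^sup>2 * g (Suc k) = ((real k + 1)\<^sup>2 * weight (Suc k)) * ((1 + z / (2 * real k + 1)) * poly (linear_factor k) z)"
      by (simp add: g_def poly_linear_factor_Suc mult_ac)
    also have "\<dots> = - ((2 * real k + 1) * ((2 * real k + 1) * (1 + z / (2 * real k + 1)))) * g k"
      unfolding weight_Suc by (simp add: g_def power2_eq_square mult_ac)
    also have "(2 * real k + 1) * (1 + z / (2 * real k + 1)) = 2 * real k + 1 + z"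
      by (simp add: distrib_left)
    finally have h: "(real k + 1)\<^sup>2 * g (Suc k) = (2 * real k + 1) * (- (2 * real k + 1 + z) * g k)"
      by (simp only: mult_minus_left mult_minus_right mult.assoc)
    have "(real k + 1)\<^sup>2 / (2 * real k + 1) * g (Suc k) = - (2 * real k + 1 + z) * g k"
      unfolding times_divide_eq_left h by (rule nonzero_mult_div_cancel_left) linarith
    then show ?thesis by (simp add: algebra_simps)
  qed
  from binomial_sum_rec_linear[of z g, OF this, of N]
  show "poly (smult ((real N + 2)\<^sup>2) (hahn_poly (N + 2))) z =
     poly (smult ((real N + 1)\<^sup>2) (hahn_poly N) - smult (2 * real N + 3) (pCons 0 (hahn_poly (N + 1)))) z"
    by (simp add: poly_hahn_poly g_def[symmetric] del: One_nat_def add_2_eq_Suc' Suc_eq_plus1)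
qed

section \<open>Parity and low coefficients\<close>

lemma coeff_delannoy_poly_rec:
  "(real N + 2) * coeff (delannoy_poly (Suc (Suc N))) j =
     coeff (pCons 0 (delannoy_poly (Suc N))) j + (real N + 1) * coeff (delannoy_poly N) j"
  by simp

lemma coeff_delannoy_poly_parity: "odd (N + j) \<Longrightarrow> coeff (delannoy_poly N) j = 0"
  by (induction N arbitrary: j rule: delannoy_poly.induct) (auto simp: coeff_pCons odd_pos split: nat.splits)

lemma coeff_hahn_poly_parity: "odd (N + j) \<Longrightarrow> coeff (hahn_poly N) j = 0"
proof (induction N arbitrary: j rule: less_induct)
  case (less N)
  consider "N = 0" | "N = 1" | M where "N = M + 2"
    by (metis One_nat_def add_2_eq_Suc' not0_implies_Suc)
  then show ?case
  proof cases
    case 1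
    then show ?thesis using less.prems by (auto simp: hahn_poly_def weight_def linear_factor_def coeff_pCons odd_pos split: nat.splits)
  next
    case 2
    then show ?thesis using less.prems
      by (auto simp: hahn_poly_def weight_def linear_factor_def coeff_pCons numeral_2_eq_2 split: nat.splits)
  next
    case 3
    have "coeff (pCons 0 (smult (2 * real M + 3) (hahn_poly (M + 1)))) j = 0"
      using less.IH[of "M + 1"] less.prems 3 by (auto simp: coeff_pCons split: nat.splits)
    moreover have "coeff (hahn_poly M) j = 0"
      using less.IH[of M] less.prems 3 by auto
    ultimately have "(real M + 2)\<^sup>2 * coeff (hahn_poly N) j = 0"
      using arg_cong[OF hahn_poly_rec[of M], of "\<lambda>p. coeff p j"] 3
      by (simp del: One_nat_def add_2_eq_Suc' Suc_eq_plus1)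
    then show ?thesis by simp
  qed
qed

lemma coeff_even_factor:
  "coeff (even_factor k) 2 = - (\<Sum>i = 1..k. 1 / (2 * real i - 1) ^ 2)"
proof -
  have "coeff (even_factor k) 0 = 1 \<and> coeff (even_factor k) 1 = 0
      \<and> coeff (even_factor k) 2 = - (\<Sum>i = 1..k. 1 / (2 * real i - 1) ^ 2)"
    by (induction k) (simp_all add: even_factor_def numeral_2_eq_2 coeff_pCons algebra_simps)
  then show ?thesis by blast
qed

text \<open>
  The second elementary symmetric function of the \<open>1 / (2i - 1)\<close>, expressed by power sums.
\<close>

lemma coeff_linear_factor:
  "coeff (linear_factor k) 2 =
     ((\<Sum>i = 1..k. 1 / (2 * real i - 1))\<^sup>2 - (\<Sum>i = 1..k. 1 / (2 * real i - 1) ^ 2)) / 2"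
proof -
  have "coeff (linear_factor k) 0 = 1 \<and> coeff (linear_factor k) 1 = (\<Sum>i = 1..k. 1 / (2 * real i - 1))
      \<and> 2 * coeff (linear_factor k) 2 = (\<Sum>i = 1..k. 1 / (2 * real i - 1))\<^sup>2 - (\<Sum>i = 1..k. 1 / (2 * real i - 1) ^ 2)"
    by (induction k) (simp_all add: linear_factor_def numeral_2_eq_2 coeff_pCons algebra_simps power_divide)
  then show ?thesis by auto
qed

text \<open>
  For odd \<open>N\<close> the constant term of the polynomial vanishes, so only the square of its linear
  coefficient contributes to \<open>z\<^sup>2\<close>.
\<close>

lemma coeff_delannoy_poly_square_odd:
  assumes "odd N"
  shows "coeff (delannoy_poly N) 1 ^ 2 =
    - (\<Sum>k\<le>N. real ((N + k) choose (2 * k)) * weight k * (\<Sum>i = 1..k. 1 / (2 * real i - 1) ^ 2))"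
proof -
  have "delannoy_poly N ^ 2 = (\<Sum>k\<le>N. smult (real ((N + k) choose (2 * k)) * weight k) (even_factor k))"
    by (rule poly_ext) (simp add: delannoy_poly_square binomial_sum_def poly_sum mult_ac)
  then have "coeff (delannoy_poly N ^ 2) 2 = coeff (\<Sum>k\<le>N. smult (real ((N + k) choose (2 * k)) * weight k) (even_factor k)) 2"
    by simp
  moreover have "coeff (delannoy_poly N ^ 2) 2 = coeff (delannoy_poly N) 1 ^ 2"
    using coeff_delannoy_poly_parity[of N 0] assms
    by (simp add: power2_eq_square coeff_mult numeral_2_eq_2)
  ultimately show ?thesis
    by (simp add: coeff_sum coeff_even_factor sum_negf)
qed

text \<open>
  The difference of the two sides is twice the coefficient of \<open>z\<^sup>2\<close> in the odd polynomial
  \<open>hahn_poly N\<close>.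
\<close>

lemma odd_harmonic_sums_eq:
  assumes "odd N"
  shows "(\<Sum>k\<le>N. real ((N + k) choose (2 * k)) * weight k * (\<Sum>i = 1..k. 1 / (2 * real i - 1))\<^sup>2) =
    (\<Sum>k\<le>N. real ((N + k) choose (2 * k)) * weight k * (\<Sum>i = 1..k. 1 / (2 * real i - 1) ^ 2))"
proof -
  have "coeff (hahn_poly N) 2 = 0" by (rule coeff_hahn_poly_parity) (use assms in simp)
  then have "(\<Sum>k\<le>N. real ((N + k) choose (2 * k)) * weight k * coeff (linear_factor k) 2) = 0"
    by (simp add: hahn_poly_def coeff_sum)
  then have "(\<Sum>k\<le>N. real ((N + k) choose (2 * k)) * weight k *
      ((\<Sum>i = 1..k. 1 / (2 * real i - 1))\<^sup>2 - (\<Sum>i = 1..k. 1 / (2 * real i - 1) ^ 2))) = 0"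
    unfolding coeff_linear_factor times_divide_eq_right sum_divide_distrib[symmetric] by simp
  then show ?thesis by (simp add: right_diff_distrib sum_subtractf)
qed

section \<open>The sequence as linear coefficients\<close>

text \<open>
  Let \<open>v\<^sub>n\<close> be the constant term of \<open>d\<^sub>2\<^sub>n\<close> and \<open>u\<^sub>n\<close> the linear coefficient of \<open>d\<^sub>2\<^sub>n\<^sub>+\<^sub>1\<close>. The recurrence for
  \<open>d\<^sub>N\<close> gives a first-order system for \<open>u\<close> and \<open>v\<close>; eliminating \<open>v\<close> leaves a second-order
  recurrence for \<open>u\<close>, which multiplication by \<open>(2n + 1)!\<close> turns into that of \<open>t_seq\<close>.
\<close>

lemma t_seq_eq_coeff: "real_of_int (t_seq n) = fact (2 * n + 1) * coeff (delannoy_poly (2 * n + 1)) 1"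
proof -
  define u where "u n = coeff (delannoy_poly (2 * n + 1)) 1" for n
  define v where "v n = coeff (delannoy_poly (2 * n)) 0" for n
  have v: "(2 * real n + 2) * v (Suc n) = (2 * real n + 1) * v n" for n
    using coeff_delannoy_poly_rec[of "2 * n" 0] by (simp add: v_def del: delannoy_poly.simps)
  have u: "(2 * real n + 3) * u (Suc n) = v (Suc n) + (2 * real n + 2) * u n" for n
    using coeff_delannoy_poly_rec[of "2 * n + 1" 1] by (simp add: v_def u_def add.commute del: delannoy_poly.simps)
  have u_rec: "(2 * real n + 4) * ((2 * real n + 5) * u (n + 2)) =
      (8 * (real n + 1)\<^sup>2 + 12 * (real n + 1) + 5) * u (n + 1) - (2 * real n + 2) * (2 * real n + 3) * u n" for n
  proof -
    have "(2 * real n + 5) * u (n + 2) = v (n + 2) + (2 * real n + 4) * u (n + 1)"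
      using u[of "Suc n"] by (simp add: add.commute)
    moreover have "(2 * real n + 4) * v (n + 2) = (2 * real n + 3) * v (n + 1)"
      using v[of "Suc n"] by (simp add: add.commute)
    moreover have "v (n + 1) = (2 * real n + 3) * u (n + 1) - (2 * real n + 2) * u n"
      using u[of n] by simp
    ultimately have "(2 * real n + 4) * ((2 * real n + 5) * u (n + 2)) =
      (2 * real n + 3) * ((2 * real n + 3) * u (n + 1) - (2 * real n + 2) * u n)
      + (2 * real n + 4) * ((2 * real n + 4) * u (n + 1))"
      by (simp add: distrib_left)
    then show ?thesis by (simp add: power2_eq_square algebra_simps)
  qed
  have "real_of_int (t_seq n) = fact (2 * n + 1) * u n"
  proof (induction n rule: t_seq.induct)
    case 1
    show ?case by (simp add: u_def)
  next
    case 2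
    have "u 0 = 1" "v 0 = 1" by (simp_all add: u_def v_def)
    then have "u (Suc 0) = 5 / 6" using u[of 0] v[of 0] by simp
    then show ?case by (simp add: fact_numeral)
  next
    case (3 m)
    define F where "F = (fact (2 * m + 1) :: real)"
    have F1: "fact (2 * Suc m + 1) = (2 * real m + 3) * (2 * real m + 2) * F"
      by (simp add: F_def algebra_simps)
    have F2: "fact (2 * Suc (Suc m) + 1) = (2 * real m + 5) * (2 * real m + 4) * ((2 * real m + 3) * (2 * real m + 2) * F)"
      unfolding F1[symmetric] by (simp add: algebra_simps)
    have "real_of_int (t_seq (Suc (Suc m))) =
        (8 * (real m + 1)\<^sup>2 + 12 * (real m + 1) + 5) * real_of_int (t_seq (Suc m))
        - 4 * (real m + 1)\<^sup>2 * (2 * real m + 3)\<^sup>2 * real_of_int (t_seq m)"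
      by (simp add: Let_def algebra_simps)
    also have "\<dots> = ((2 * real m + 3) * (2 * real m + 2) * F) *
       ((8 * (real m + 1)\<^sup>2 + 12 * (real m + 1) + 5) * u (m + 1) - (2 * real m + 2) * (2 * real m + 3) * u m)"
      using 3 unfolding F1 F_def[symmetric] by (simp add: Let_def power2_eq_square algebra_simps del: t_seq.simps)
    also have "\<dots> = fact (2 * Suc (Suc m) + 1) * u (Suc (Suc m))"
      unfolding F2 u_rec[symmetric] by (simp add: mult_ac)
    finally show ?case .
  qed
  then show ?thesis by (simp add: u_def)
qed

theorem theorem3p2:
  fixes n :: nat
  shows "(real_of_int (t_seq n)) ^ 2 =
      - ((fact (2 * n + 1) :: real) ^ 2) *
        (\<Sum>k = 0..2 * n + 1.
           real ((2 * n + 1 + k) choose (2 * k)) * real ((2 * k) choose k) ^ 2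
             * (1 / (- 4) ^ k) * (\<Sum>i = 1..k. 1 / (2 * real i - 1) ^ 2))
    \<and> (real_of_int (t_seq n)) ^ 2 =
      - ((fact (2 * n + 1) :: real) ^ 2) *
        (\<Sum>k = 0..2 * n + 1.
           real ((2 * n + 1 + k) choose (2 * k)) * real ((2 * k) choose k) ^ 2
             * (1 / (- 4) ^ k) * (\<Sum>i = 1..k. 1 / (2 * real i - 1)) ^ 2)"
proof -
  have "odd (2 * n + 1)" by simp
  note A = coeff_delannoy_poly_square_odd[OF this] and B = odd_harmonic_sums_eq[OF this]
  have "real_of_int (t_seq n) ^ 2 = - ((fact (2 * n + 1) :: real) ^ 2) *
      (\<Sum>k\<le>2 * n + 1. real ((2 * n + 1 + k) choose (2 * k)) * weight k * (\<Sum>i = 1..k. 1 / (2 * real i - 1) ^ 2))"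
    unfolding t_seq_eq_coeff power_mult_distrib A by (simp only: mult_minus_left mult_minus_right)
  then show ?thesis
    using B by (simp only: atLeast0AtMost weight_def mult.assoc simp_thms)
qed

end
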